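(* Consider the system $\dot u=A(u)$, $u\in\mathbb{R}^n$, with observable $y=b(u)\in\mathbb{R}^m$, $m\le n$, and let $K\subset\mathbb{R}^n$ be a compact forward-invariant set. Assume the system has diminishing ambiguity (DA) with constants $\alpha>0$ and $C>0$. Then: (i) There exists a well-defined operator $L_\infty:\mathcal H_\infty\to\mathbb{R}^m$ such that for every admissible trajectory $\dot y(0^+)=L_\infty(y_{0,\infty})$; more generally, $\dot y(t^+)=L_\infty(y_{t,\infty})$ for all $t$. (ii) For each $h>0$ there exists a map $L_h:\mathcal H_h\to\mathbb{R}^m$, defined up to $O(e^{-\alpha h})$ ambiguity (that is, any two maps satisfying the following bound differ by $O(e^{-\alpha h})$, uniformly on $\mathcal H_h$), such that for every admissible trajectory $$\|\dot y(0^+)-L_h(y_{0,h})\|\le Ce^{-\alpha h}.$$ Consequently, for every admissible trajectory and all $t$, one has the finite-memory approximation $$\dot y(t^+)=L_h(y_{t,h})+r_h(t),\qquad \|r_h(t)\|\le Ce^{-\alpha h}.$$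
   Context: The ODE $\dot u=A(u)$ is autonomous and assumed to have existence and uniqueness of solutions. The set $K\subset\mathbb{R}^n$ is a fixed compact forward-invariant set, and all trajectories are assumed to remain in $K$ on the time intervals under discussion. For a trajectory $u$ with observable $y(t)=b(u(t))$, $\dot y(t^+)$ denotes the right derivative of $y$ at $t$, which is assumed to exist and is given by $\dot y(t^+)=\ell(u(t))$ with the Lie derivative $\ell(u)=Db(u)A(u)$. Admissible trajectory: a solution $u$ of the ODE defined on all of $\mathbb{R}$ with values in $K$ (a solution with $u(t)\in K$ for all $t\le0$ stays in $K$ for $t\ge 0$ by forward invariance), together with its observable $y=b(u)$. History segments: for $h\in(0,\infty)$, $y_{t,h}(\theta):=y(t+\theta)$ for $\theta\in[-h,0]$; $y_{t,\infty}(\theta):=y(t+\theta)$ for $\theta\in(-\infty,0]$. Admissible histories: $\mathcal H_\infty$ is the set of functions $\phi:(-\infty,0]\to\mathbb{R}^m$ for which there is a trajectory $u$ of the ODE with $u(t)\in K$ for all $t\le 0$ and $\phi(\theta)=b(u(\theta))$ for all $\theta\le0$. For $h<\infty$, $\mathcal H_h:=\{\phi|_{[-h,0]}:\phi\in\mathcal H_\infty\}$. Diminishing ambiguity (DA) with constants $\alpha>0$, $C>0$: for any $T>0$ and any two trajectories $u_1,u_2$ in $K$ (solutions on $[-T,\infty)$ with values in $K$), with observables $y_i=b(u_i)$, satisfying $y_1(t)=y_2(t)$ for all $t\in[-T,0]$, one has $\|\dot y_1(0^+)-\dot y_2(0^+)\|\le Ce^{-\alpha T}$. The system has DA if such constants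 exist. *)

theory Defs
  imports "HOL-Analysis.Analysis"
begin

(* Functions of time are total in HOL; a solution "defined on S" is constrained on S only.
   At an endpoint belonging to S the derivative is one-sided. *)
definition ode_solution :: "(real ^ 'n \<Rightarrow> real ^ 'n) \<Rightarrow> (real \<Rightarrow> real ^ 'n) \<Rightarrow> real set \<Rightarrow> bool" where
  "ode_solution A u S \<longleftrightarrow> (\<forall>t\<in>S. (u has_vector_derivative A (u t)) (at t within S))"

definition ode_existence :: "(real ^ 'n \<Rightarrow> real ^ 'n) \<Rightarrow> bool" where
  "ode_existence A \<longleftrightarrow> (\<forall>x. \<exists>\<epsilon>>0. \<exists>u. u 0 = x \<and> ode_solution A u {-\<epsilon><..<\<epsilon>})"

definition ode_uniqueness :: "(real ^ 'n \<Rightarrow> real ^ 'n) \<Rightarrow> bool" where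
  "ode_uniqueness A \<longleftrightarrow>
     (\<forall>S u v. \<forall>s\<in>S. is_interval S \<and> ode_solution A u S \<and> ode_solution A v S \<and> u s = v s
        \<longrightarrow> (\<forall>t\<in>S. u t = v t))"

(* The semiflow is defined on K for all t >= 0 and maps K into K.  Since the ODE is
   autonomous, it suffices to start at time 0. *)
definition forward_invariant :: "(real ^ 'n \<Rightarrow> real ^ 'n) \<Rightarrow> (real ^ 'n) set \<Rightarrow> bool" where
  "forward_invariant A K \<longleftrightarrow>
     (\<forall>x\<in>K. (\<exists>u. u 0 = x \<and> ode_solution A u {0..}) \<and>
            (\<forall>u T. u 0 = x \<and> ode_solution A u {0..T} \<longrightarrow> (\<forall>t\<in>{0..T}. u t \<in> K)))"

definition trajectory_in ::
  "(real ^ 'n \<Rightarrow> real ^ 'n) \<Rightarrow> (real ^ 'n) set \<Rightarrow> (real \<Rightarrow> real ^ 'n) \<Rightarrow> real set \<Rightarrow> bool" where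
  "trajectory_in A K u S \<longleftrightarrow> ode_solution A u S \<and> (\<forall>t\<in>S. u t \<in> K)"

abbreviation admissible ::
  "(real ^ 'n \<Rightarrow> real ^ 'n) \<Rightarrow> (real ^ 'n) set \<Rightarrow> (real \<Rightarrow> real ^ 'n) \<Rightarrow> bool" where
  "admissible A K u \<equiv> trajectory_in A K u UNIV"

definition right_deriv :: "(real \<Rightarrow> real ^ 'm) \<Rightarrow> real \<Rightarrow> real ^ 'm" where
  "right_deriv y t = vector_derivative y (at_right t)"

definition lie_derivative ::
  "(real ^ 'n \<Rightarrow> real ^ 'n) \<Rightarrow> (real ^ 'n \<Rightarrow> real ^ 'm) \<Rightarrow> real ^ 'n \<Rightarrow> real ^ 'm" where
  "lie_derivative A b x = frechet_derivative b (at x) (A x)"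

(* If b is differentiable at the points of K, so that Db makes sense there, observables
   have right derivatives along trajectories in K, given by the Lie derivative. *)
lemma observable_right_deriv:
  assumes b: "\<forall>x\<in>K. b differentiable (at x)"
    and u: "trajectory_in A K u S" and S: "{t..} \<subseteq> S"
  shows "((b \<circ> u) has_vector_derivative lie_derivative A b (u t)) (at_right t)"
    and "right_deriv (b \<circ> u) t = lie_derivative A b (u t)"
proof -
  have tS: "t \<in> S" "{t<..} \<subseteq> S" using S by auto
  have du: "(u has_vector_derivative A (u t)) (at_right t)"
    using u tS unfolding trajectory_in_def ode_solution_def
    by (blast intro: has_vector_derivative_within_subset)
  have "(b has_derivative frechet_derivative b (at (u t))) (at (u t) within u ` {t<..})"
    using b u tS frechet_derivative_works has_derivative_at_withinI
    unfolding trajectory_in_def by blast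
  from vector_derivative_diff_chain_within[OF du this]
  show "((b \<circ> u) has_vector_derivative lie_derivative A b (u t)) (at_right t)"
    by (simp add: lie_derivative_def)
  then show "right_deriv (b \<circ> u) t = lie_derivative A b (u t)"
    unfolding right_deriv_def
    by (intro vector_derivative_within) (simp_all add: trivial_limit_at_right_real)
qed

(* The history segment of y at t over the window S: S = {-h..0} for memory length h < oo
   and S = {..0} for infinite memory.  Restriction makes it a function with domain S. *)
definition history :: "real set \<Rightarrow> (real \<Rightarrow> real ^ 'm) \<Rightarrow> real \<Rightarrow> real \<Rightarrow> real ^ 'm" where
  "history S y t = restrict (\<lambda>\<theta>. y (t + \<theta>)) S"

definition histories_inf ::
  "(real ^ 'n \<Rightarrow> real ^ 'n) \<Rightarrow> (real ^ 'n \<Rightarrow> real ^ 'm) \<Rightarrow> (real ^ 'n) set \<Rightarrow> (real \<Rightarrow> real ^ 'm) set" where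
  "histories_inf A b K = {restrict (b \<circ> u) {..0} | u. trajectory_in A K u {..0}}"

definition histories ::
  "(real ^ 'n \<Rightarrow> real ^ 'n) \<Rightarrow> (real ^ 'n \<Rightarrow> real ^ 'm) \<Rightarrow> (real ^ 'n) set \<Rightarrow> real \<Rightarrow> (real \<Rightarrow> real ^ 'm) set" where
  "histories A b K h = (\<lambda>\<phi>. restrict \<phi> {-h..0}) ` histories_inf A b K"

definition diminishing_ambiguity ::
  "(real ^ 'n \<Rightarrow> real ^ 'n) \<Rightarrow> (real ^ 'n \<Rightarrow> real ^ 'm) \<Rightarrow> (real ^ 'n) set \<Rightarrow> real \<Rightarrow> real \<Rightarrow> bool" where
  "diminishing_ambiguity A b K \<alpha> C \<longleftrightarrow>
     (\<forall>T>0. \<forall>u1 u2. trajectory_in A K u1 {-T..} \<and> trajectory_in A K u2 {-T..} \<and>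
        (\<forall>t\<in>{-T..0}. b (u1 t) = b (u2 t)) \<longrightarrow>
        norm (right_deriv (b \<circ> u1) 0 - right_deriv (b \<circ> u2) 0) \<le> C * exp (- \<alpha> * T))"

(* Maps L : H_h -> R^m, extensional so that they have domain exactly H_h. *)
definition finite_memory_map ::
  "(real ^ 'n \<Rightarrow> real ^ 'n) \<Rightarrow> (real ^ 'n \<Rightarrow> real ^ 'm) \<Rightarrow> (real ^ 'n) set \<Rightarrow> real \<Rightarrow> real \<Rightarrow> real
     \<Rightarrow> ((real \<Rightarrow> real ^ 'm) \<Rightarrow> real ^ 'm) \<Rightarrow> bool" where
  "finite_memory_map A b K \<alpha> C h L \<longleftrightarrow>
     L \<in> histories A b K h \<rightarrow>\<^sub>E UNIV \<and>
     (\<forall>u. admissible A K u \<longrightarrow>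
        norm (right_deriv (b \<circ> u) 0 - L (history {-h..0} (b \<circ> u) 0)) \<le> C * exp (- \<alpha> * h))"

end

theory Submission
  imports Defs
begin

text \<open>
  Diminishing ambiguity compares two trajectories that share an observable history of length
  \<open>T\<close>. If they share the whole past, it applies for every \<open>T\<close>, and letting
  \<open>T \<rightarrow> \<infinity>\<close> forces their observable velocities to coincide: the velocity is a
  function of the infinite history. If they share only the last \<open>h\<close> time units, the velocities
  agree up to \<open>C exp (-\<alpha> h)\<close>, so that the velocity of any trajectory chosen as a representative
  of its history serves as the value of the finite-memory map, with the constant \<open>C\<close> itself.

  Two facts make this work at all times and on all admissible histories. Because the equation is
  autonomous, time shifts preserve admissibility, so statements at time \<open>0\<close> transfer to
  every \<open>t\<close>. Because \<open>K\<close> is forward invariant, a trajectory of the past extends to an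
  admissible one, so every history in \<open>\<H>\<^sub>\<infinity>\<close> or \<open>\<H>\<^sub>h\<close> is realised by an
  admissible trajectory; two finite-memory maps are then both within \<open>C exp (-\<alpha> h)\<close> of
  the same velocity and hence within \<open>2 C exp (-\<alpha> h)\<close> of each other.
\<close>

lemma trajectory_in_subset:
  assumes "trajectory_in A K u S" "R \<subseteq> S"
  shows "trajectory_in A K u R"
  using assms unfolding trajectory_in_def ode_solution_def
  by (blast intro: has_vector_derivative_within_subset)

lemma admissible_shift:
  assumes "admissible A K u"
  shows "admissible A K (\<lambda>s. u (t + s))"
proof -
  have "((\<lambda>s. u (t + s)) has_vector_derivative A (u (t + s))) (at s)" for s
  proof -
    have shift: "((\<lambda>s. t + s) has_vector_derivative 1) (at s)"
      by (auto intro!: derivative_eq_intros)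
    have "(u has_vector_derivative A (u (t + s))) (at (t + s))"
      using assms unfolding trajectory_in_def ode_solution_def by blast
    from vector_diff_chain_at[OF shift this] show ?thesis
      by (simp add: o_def)
  qed
  then show ?thesis
    using assms unfolding trajectory_in_def ode_solution_def by blast
qed

lemma history_shift:
  "history S (b \<circ> u) t = history S (b \<circ> (\<lambda>s. u (t + s))) 0"
  by (simp add: history_def o_def)

lemma history_eq_iff:
  "history S y t = history S z s \<longleftrightarrow> (\<forall>\<theta>\<in>S. y (t + \<theta>) = z (s + \<theta>))"
  by (auto simp: history_def restrict_def fun_eq_iff)

text \<open>
  The observable velocity depends on the current state only, by the chain rule along
  trajectories; hence it commutes with time shifts.
\<close>

lemma right_deriv_shift:
  assumes "\<forall>x\<in>K. b differentiable (at x)" and "admissible A K u"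
  shows "right_deriv (b \<circ> u) t = right_deriv (b \<circ> (\<lambda>s. u (t + s))) 0"
  using observable_right_deriv(2)[OF assms(1) assms(2), of t]
    observable_right_deriv(2)[OF assms(1) admissible_shift[OF assms(2), of t], of 0]
  by simp

text \<open>
  Forward invariance provides a solution on \<open>[0,\<infinity>)\<close> that starts at the present state and
  remains in \<open>K\<close>. Gluing it to the past produces no kink at \<open>0\<close>, because both
  one-sided derivatives there equal \<open>A (u 0)\<close>.
\<close>

lemma trajectory_extends:
  assumes inv: "forward_invariant A K" and u: "trajectory_in A K u {..0}"
  obtains v where "admissible A K v" "\<And>t. t \<le> 0 \<Longrightarrow> v t = u t"
proof -
  have "u 0 \<in> K" using u unfolding trajectory_in_def by simp
  then obtain w where w0: "w 0 = u 0" and w: "ode_solution A w {0..}"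
    and stay: "\<And>T. ode_solution A w {0..T} \<Longrightarrow> \<forall>t\<in>{0..T}. w t \<in> K"
    using inv unfolding forward_invariant_def by metis
  have wK: "w t \<in> K" if "t \<ge> 0" for t
  proof -
    have "ode_solution A w {0..t}"
      using w unfolding ode_solution_def
      by (fastforce intro: has_vector_derivative_within_subset[where S = "{0..}"])
    from stay[OF this] that show ?thesis by simp
  qed
  define v where "v t = (if t \<in> {..0} then u t else w t)" for t
  have "(v has_vector_derivative A (v t)) (at t)" for t
  proof -
    have overlap: "closure {..0} \<inter> closure {0::real<..} = {0}" by auto
    have past: "(u has_vector_derivative A (u s)) (at s within {..0})" if "s \<le> 0" for s
      using u that unfolding trajectory_in_def ode_solution_def by simp
    have future: "(w has_vector_derivative A (w s)) (at s within {0..})" if "s \<ge> 0" for s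
      using w that unfolding ode_solution_def by simp
    have "((\<lambda>s. if s \<in> {..0} then u s else w s) has_vector_derivative
        (if t \<in> {..0} then A (u t) else A (w t))) (at t within {..0} \<union> {0<..})"
    proof (rule has_vector_derivative_If_within_closures
        [where f' = "\<lambda>s. A (u s)" and g' = "\<lambda>s. A (w s)"])
      show "(u has_vector_derivative A (u t))
          (at t within {..0} \<union> closure {..0} \<inter> closure {0<..})"
        if "t \<in> {..0} \<union> closure {..0} \<inter> closure {0<..}"
        unfolding overlap
        using past[of t] that by (simp add: overlap insert_absorb)
      show "(w has_vector_derivative A (w t))
          (at t within {0<..} \<union> closure {..0} \<inter> closure {0<..})"
        if "t \<in> {0<..} \<union> closure {..0} \<inter> closure {0<..}"
      proof -
        have "{0<..} \<union> closure {..0} \<inter> closure {0<..} = {0::real..}"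
          unfolding overlap by auto
        with future[of t] that show ?thesis by auto
      qed
      show "u t = w t" "A (u t) = A (w t)"
        if "t \<in> closure {..0}" "t \<in> closure {0<..}"
      proof -
        from that overlap have "t = 0" by blast
        then show "u t = w t" "A (u t) = A (w t)" by (simp_all add: w0)
      qed
    qed auto
    moreover have "{..0} \<union> {0<..} = (UNIV :: real set)" by auto
    ultimately show ?thesis
      unfolding v_def[abs_def] by (simp split: if_splits)
  qed
  moreover have "v t \<in> K" for t
    using wK u unfolding v_def trajectory_in_def by auto
  ultimately have "admissible A K v"
    unfolding trajectory_in_def ode_solution_def by simp
  then show thesis by (rule that) (simp add: v_def)
qed

text \<open>
  Histories are defined from trajectories of the past alone, whereas velocity bounds concern
  trajectories on all of \<open>\<real>\<close>; \<open>trajectory_extends\<close> reconciles the two.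
\<close>

lemma histories_inf_eq:
  assumes "forward_invariant A K"
  shows "histories_inf A b K = {history {..0} (b \<circ> u) 0 | u. admissible A K u}"
proof (intro equalityI subsetI)
  fix \<phi> assume "\<phi> \<in> histories_inf A b K"
  then obtain u where u: "trajectory_in A K u {..0}" and \<phi>: "\<phi> = restrict (b \<circ> u) {..0}"
    unfolding histories_inf_def by blast
  obtain v where "admissible A K v" "\<And>t. t \<le> 0 \<Longrightarrow> v t = u t"
    by (rule trajectory_extends[OF assms u]) blast
  moreover from this(2) have "\<phi> = history {..0} (b \<circ> v) 0"
    unfolding \<phi> history_def by (auto intro: restrict_ext)
  ultimately show "\<phi> \<in> {history {..0} (b \<circ> u) 0 | u. admissible A K u}" by blast
next
  fix \<phi> assume "\<phi> \<in> {history {..0} (b \<circ> u) 0 | u. admissible A K u}"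
  then obtain u where u: "admissible A K u" and \<phi>: "\<phi> = history {..0} (b \<circ> u) 0"
    by blast
  have "\<phi> = restrict (b \<circ> u) {..0}"
    unfolding \<phi> history_def by (simp add: o_def)
  with trajectory_in_subset[OF u subset_UNIV] show "\<phi> \<in> histories_inf A b K"
    unfolding histories_inf_def by blast
qed

lemma histories_eq:
  assumes "forward_invariant A K"
  shows "histories A b K h = {history {-h..0} (b \<circ> u) 0 | u. admissible A K u}"
proof -
  have restr: "restrict (history {..0} (b \<circ> u) 0) {-h..0} = history {-h..0} (b \<circ> u) 0" for u
    unfolding history_def by (simp add: restrict_restrict Int_absorb1)
  show ?thesis
    unfolding histories_def histories_inf_eq[OF assms(1)] restr[symmetric] by blast
qed

lemma ambiguity_finite_history:
  assumes "diminishing_ambiguity A b K \<alpha> C" "T > 0"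
    and "admissible A K u" "admissible A K v"
    and "history {-T..0} (b \<circ> u) 0 = history {-T..0} (b \<circ> v) 0"
  shows "norm (right_deriv (b \<circ> u) 0 - right_deriv (b \<circ> v) 0) \<le> C * exp (- \<alpha> * T)"
proof -
  have "\<forall>t\<in>{-T..0}. b (u t) = b (v t)"
    using assms(5) by (simp add: history_eq_iff)
  moreover have "trajectory_in A K u {-T..}" "trajectory_in A K v {-T..}"
    by (rule trajectory_in_subset[OF _ subset_UNIV], fact)+
  ultimately show ?thesis
    using assms(1)[unfolded diminishing_ambiguity_def, rule_format, OF assms(2), of u v] by simp
qed

text \<open>
  An infinite common past contains common windows of every length \<open>T\<close>, and the ambiguity
  bound vanishes as \<open>T \<rightarrow> \<infinity>\<close>.
\<close>

lemma velocity_determined_by_infinite_history: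
  assumes DA: "diminishing_ambiguity A b K \<alpha> C" and \<alpha>: "\<alpha> > 0"
    and u: "admissible A K u" and v: "admissible A K v"
    and eq: "history {..0} (b \<circ> u) 0 = history {..0} (b \<circ> v) 0"
  shows "right_deriv (b \<circ> u) 0 = right_deriv (b \<circ> v) 0"
proof -
  let ?d = "norm (right_deriv (b \<circ> u) 0 - right_deriv (b \<circ> v) 0)"
  have bound: "?d \<le> C * exp (- \<alpha> * T)" if "T > 0" for T
  proof -
    have "history {-T..0} (b \<circ> u) 0 = history {-T..0} (b \<circ> v) 0"
      using eq unfolding history_eq_iff by (meson atLeastAtMost_iff atMost_iff)
    then show ?thesis
      using ambiguity_finite_history[OF DA that u v] by blast
  qed
  have "filterlim (\<lambda>T. - \<alpha> * T) at_bot at_top"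
    by (rule filterlim_tendsto_neg_mult_at_bot[OF tendsto_const _ filterlim_ident])
      (use \<alpha> in simp)
  then have "((\<lambda>T. C * exp (- \<alpha> * T)) \<longlongrightarrow> C * 0) at_top"
    by (intro tendsto_mult_left filterlim_compose[OF exp_at_bot])
  moreover have "eventually (\<lambda>T. ?d \<le> C * exp (- \<alpha> * T)) at_top"
    using eventually_gt_at_top[of 0] by eventually_elim (rule bound)
  ultimately have "?d \<le> C * 0"
    by (rule tendsto_lowerbound) simp
  then show ?thesis by simp
qed

text \<open>
  A candidate for both operators: the velocity of some admissible trajectory with the prescribed
  history over the window \<open>S\<close>. Under diminishing ambiguity the choice is immaterial for
  the infinite window and changes the value by at most \<open>C exp (-\<alpha> h)\<close> for a window of
  length \<open>h\<close>.
\<close>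

definition representative_velocity ::
  "(real ^ 'n \<Rightarrow> real ^ 'n) \<Rightarrow> (real ^ 'n \<Rightarrow> real ^ 'm) \<Rightarrow> (real ^ 'n) set \<Rightarrow> real set
     \<Rightarrow> (real \<Rightarrow> real ^ 'm) set \<Rightarrow> (real \<Rightarrow> real ^ 'm) \<Rightarrow> real ^ 'm" where
  "representative_velocity A b K S H =
     restrict (\<lambda>\<phi>. right_deriv
       (b \<circ> (SOME u. admissible A K u \<and> history S (b \<circ> u) 0 = \<phi>)) 0) H"

lemma representative_velocity_witness:
  assumes "admissible A K u" and "history S (b \<circ> u) 0 \<in> H"
  obtains v where "admissible A K v" "history S (b \<circ> v) 0 = history S (b \<circ> u) 0"
    "representative_velocity A b K S H (history S (b \<circ> u) 0) = right_deriv (b \<circ> v) 0"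
proof -
  define v where
    "v = (SOME v. admissible A K v \<and> history S (b \<circ> v) 0 = history S (b \<circ> u) 0)"
  have "admissible A K v \<and> history S (b \<circ> v) 0 = history S (b \<circ> u) 0"
    unfolding v_def by (rule someI[of _ u]) (simp add: assms(1))
  moreover have
    "representative_velocity A b K S H (history S (b \<circ> u) 0) = right_deriv (b \<circ> v) 0"
    using assms(2) by (simp add: representative_velocity_def v_def)
  ultimately show thesis using that by blast
qed

lemma infinite_memory_operator_exists:
  assumes inv: "forward_invariant A K" and diff: "\<forall>x\<in>K. b differentiable (at x)"
    and \<alpha>: "\<alpha> > 0" and DA: "diminishing_ambiguity A b K \<alpha> C"
  shows "\<exists>L \<in> histories_inf A b K \<rightarrow>\<^sub>E UNIV. \<forall>u. admissible A K u \<longrightarrow>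
    (\<forall>t. right_deriv (b \<circ> u) t = L (history {..0} (b \<circ> u) t))"
proof -
  let ?L = "representative_velocity A b K {..0} (histories_inf A b K)"
  have at_0: "right_deriv (b \<circ> u) 0 = ?L (history {..0} (b \<circ> u) 0)"
    if u: "admissible A K u" for u
  proof -
    have "history {..0} (b \<circ> u) 0 \<in> histories_inf A b K"
      using u unfolding histories_inf_eq[OF inv] by blast
    from representative_velocity_witness[OF u this] obtain v where "admissible A K v"
      "history {..0} (b \<circ> v) 0 = history {..0} (b \<circ> u) 0"
      "?L (history {..0} (b \<circ> u) 0) = right_deriv (b \<circ> v) 0" by blast
    then show ?thesis
      using velocity_determined_by_infinite_history[OF DA \<alpha> u] by simp
  qed
  have "right_deriv (b \<circ> u) t = ?L (history {..0} (b \<circ> u) t)"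
    if "admissible A K u" for u t
    unfolding right_deriv_shift[OF diff that, of t] history_shift[of _ b u t]
    by (rule at_0[OF admissible_shift[OF that]])
  moreover have "?L \<in> histories_inf A b K \<rightarrow>\<^sub>E UNIV"
    unfolding representative_velocity_def by auto
  ultimately show ?thesis by blast
qed

lemma finite_memory_map_exists:
  assumes inv: "forward_invariant A K" and DA: "diminishing_ambiguity A b K \<alpha> C" and h: "h > 0"
  shows "\<exists>L. finite_memory_map A b K \<alpha> C h L"
proof -
  let ?L = "representative_velocity A b K {-h..0} (histories A b K h)"
  have "norm (right_deriv (b \<circ> u) 0 - ?L (history {-h..0} (b \<circ> u) 0)) \<le> C * exp (- \<alpha> * h)"
    if u: "admissible A K u" for u
  proof -
    have "history {-h..0} (b \<circ> u) 0 \<in> histories A b K h"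
      using u unfolding histories_eq[OF inv] by blast
    from representative_velocity_witness[OF u this] obtain v where "admissible A K v"
      "history {-h..0} (b \<circ> v) 0 = history {-h..0} (b \<circ> u) 0"
      "?L (history {-h..0} (b \<circ> u) 0) = right_deriv (b \<circ> v) 0" by blast
    then show ?thesis
      using ambiguity_finite_history[OF DA h u] by simp
  qed
  moreover have "?L \<in> histories A b K h \<rightarrow>\<^sub>E UNIV"
    unfolding representative_velocity_def by auto
  ultimately show ?thesis unfolding finite_memory_map_def by blast
qed

lemma finite_memory_maps_close:
  assumes inv: "forward_invariant A K"
    and L: "finite_memory_map A b K \<alpha> C h L" and L': "finite_memory_map A b K \<alpha> C h L'"
    and \<phi>: "\<phi> \<in> histories A b K h"
  shows "norm (L \<phi> - L' \<phi>) \<le> 2 * C * exp (- \<alpha> * h)"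
proof -
  from \<phi> obtain u where u: "admissible A K u" and \<phi>_eq: "\<phi> = history {-h..0} (b \<circ> u) 0"
    unfolding histories_eq[OF inv] by blast
  let ?d = "right_deriv (b \<circ> u) 0"
  have "norm (?d - L \<phi>) \<le> C * exp (- \<alpha> * h)" "norm (?d - L' \<phi>) \<le> C * exp (- \<alpha> * h)"
    using L L' u unfolding finite_memory_map_def \<phi>_eq by blast+
  moreover have "norm (L \<phi> - L' \<phi>) \<le> norm (?d - L \<phi>) + norm (?d - L' \<phi>)"
    using norm_triangle_ineq4[of "?d - L' \<phi>" "?d - L \<phi>"] by simp
  ultimately show ?thesis by simp
qed

lemma finite_memory_approximation:
  assumes diff: "\<forall>x\<in>K. b differentiable (at x)"
    and L: "finite_memory_map A b K \<alpha> C h L" and u: "admissible A K u"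
  shows "norm (right_deriv (b \<circ> u) t - L (history {-h..0} (b \<circ> u) t)) \<le> C * exp (- \<alpha> * h)"
  using L admissible_shift[OF u, of t]
  unfolding right_deriv_shift[OF diff u, of t] history_shift[of _ b u t] finite_memory_map_def
  by blast

theorem theorem4p4:
  fixes A :: "real ^ 'n \<Rightarrow> real ^ 'n"
    and b :: "real ^ 'n \<Rightarrow> real ^ 'm"
    and K :: "(real ^ 'n) set"
    and \<alpha> C :: real
  assumes dims: "CARD('m) \<le> CARD('n)"
    and existence: "ode_existence A"
    and uniqueness: "ode_uniqueness A"
    and compact: "compact K"
    and invariant: "forward_invariant A K"
    and differentiable: "\<forall>x\<in>K. b differentiable (at x)"
    and alpha: "\<alpha> > 0"
    and C: "C > 0"
    and DA: "diminishing_ambiguity A b K \<alpha> C"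
  shows
    "(\<exists>L \<in> histories_inf A b K \<rightarrow>\<^sub>E UNIV.
        \<forall>u. admissible A K u \<longrightarrow>
          right_deriv (b \<circ> u) 0 = L (history {..0} (b \<circ> u) 0) \<and>
          (\<forall>t. right_deriv (b \<circ> u) t = L (history {..0} (b \<circ> u) t)))
     \<and>
     (\<exists>M. \<forall>h>0.
        (\<exists>L. finite_memory_map A b K \<alpha> C h L) \<and>
        (\<forall>L L'. finite_memory_map A b K \<alpha> C h L \<and> finite_memory_map A b K \<alpha> C h L' \<longrightarrow>
           (\<forall>\<phi>\<in>histories A b K h. norm (L \<phi> - L' \<phi>) \<le> M * exp (- \<alpha> * h))) \<and>
        (\<forall>L. finite_memory_map A b K \<alpha> C h L \<longrightarrow>
           (\<forall>u. admissible A K u \<longrightarrow>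
              (\<exists>r. \<forall>t. right_deriv (b \<circ> u) t = L (history {-h..0} (b \<circ> u) t) + r t \<and>
                       norm (r t) \<le> C * exp (- \<alpha> * h)))))"
proof (intro conjI exI[of _ "2 * C"] allI impI ballI)
  show "\<exists>L \<in> histories_inf A b K \<rightarrow>\<^sub>E UNIV.
        \<forall>u. admissible A K u \<longrightarrow>
          right_deriv (b \<circ> u) 0 = L (history {..0} (b \<circ> u) 0) \<and>
          (\<forall>t. right_deriv (b \<circ> u) t = L (history {..0} (b \<circ> u) t))"
    using infinite_memory_operator_exists[OF invariant differentiable alpha DA] by blast
next
  fix h :: real
  assume h: "h > 0"
  show "\<exists>L. finite_memory_map A b K \<alpha> C h L"
    by (rule finite_memory_map_exists[OF invariant DA h])
  show "norm (L \<phi> - L' \<phi>) \<le> 2 * C * exp (- \<alpha> * h)"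
    if "finite_memory_map A b K \<alpha> C h L \<and> finite_memory_map A b K \<alpha> C h L'"
      and "\<phi> \<in> histories A b K h" for L L' \<phi>
    using finite_memory_maps_close[OF invariant] that by blast
  show "\<exists>r. \<forall>t. right_deriv (b \<circ> u) t = L (history {-h..0} (b \<circ> u) t) + r t \<and>
                 norm (r t) \<le> C * exp (- \<alpha> * h)"
    if "finite_memory_map A b K \<alpha> C h L" and "admissible A K u" for L u
    using finite_memory_approximation[OF differentiable that]
    by (intro exI[of _ "\<lambda>t. right_deriv (b \<circ> u) t - L (history {-h..0} (b \<circ> u) t)"]) simp
qed

end
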